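(* $\mathfrak{se} = \mathfrak{e}_\ell = \min\{\mathfrak{e},\mathfrak{b}\}$.
   Context: $\mathbb Z^\omega$ is the direct product of countably many copies of $\mathbb Z$, and $e_n\in\mathbb Z^\omega$ is the $n$-th unit vector. The Specker–Eda number $\mathfrak{se}$ is the least cardinality of a subgroup $G\le\mathbb Z^\omega$ containing all unit vectors $e_n$ such that every group homomorphism $h:G\to\mathbb Z$ satisfies $h(e_n)=0$ for all but finitely many $n$. The unbounding number $\mathfrak b$ is the least size of a family $\mathcal F\subseteq\omega^\omega$ such that for every $g\in\omega^\omega$ some $f\in\mathcal F$ satisfies $f(n)>g(n)$ for infinitely many $n$. For a countable set $S$, an $S$-valued predictor is a pair $\pi=(D_\pi,\langle\pi_n:n\in D_\pi\rangle)$ with $D_\pi\subseteq\omega$ infinite and $\pi_n:S^n\to S$; $\pi$ predicts $f\in S^\omega$ if $f(n)=\pi_n(f\restriction n)$ for all but finitely many $n\in D_\pi$. The evasion number $\mathfrak e$ is the least size of $\mathcal F\subseteq\omega^\omega$ such that no $\omega$-valued predictor predicts all $f\in\mathcal F$. A linear predictor is a pair $\pi=(D_\pi,\langle\pi_n:n\in D_\pi\rangle)$ with $D_\pi\subseteq\omega$ infinite and each $\pi_n:\mathbb Z^n\to\mathbb Q$ (the restriction of) a $\mathbb Q$-linear map; it predicts $f\in\mathbb Z^\omega$ if $f(n)=\pi_n(f\restriction n)$ for all but finitely many $n\in D_\pi$. The linear evasion number $\mathfrak e_\ell$ is the least size of $\mathcal F\subseteq\mathbb Z^\omega$ such that no linear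 predictor predicts all $f\in\mathcal F$. *)

theory Defs
  imports
    "HOL-Algebra.Elementary_Groups"
    "HOL-Algebra.Product_Groups"
    "Jordan_Normal_Form.Matrix"
begin

unbundle cardinal_syntax

text \<open>
  Cardinals are represented by cardinal orders and compared up to \<open>=o\<close>. The value below is
  meaningful (and then unique up to \<open>=o\<close>) whenever some set satisfies \<open>P\<close>.
\<close>

definition least_card :: "('a set \<Rightarrow> bool) \<Rightarrow> 'a rel" where
  "least_card P = |SOME A. P A \<and> (\<forall>B. P B \<longrightarrow> |A| \<le>o |B| )|"

lemma least_card:
  assumes "P A"
  shows "\<exists>A. P A \<and> least_card P = |A|" and "\<And>B. P B \<Longrightarrow> least_card P \<le>o |B|"
proof -
  let ?Q = "\<lambda>A. P A \<and> (\<forall>B. P B \<longrightarrow> |A| \<le>o |B| )"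
  have "card_of ` {A. P A} \<noteq> {}" "\<forall>r \<in> card_of ` {A. P A}. Card_order r"
    using assms by (auto intro: card_of_Card_order)
  then have "\<exists>A. ?Q A"
    using exists_minim_Card_order[of "card_of ` {A. P A}"] by auto
  then have "?Q (SOME A. ?Q A)" by (rule someI_ex)
  then show "\<exists>A. P A \<and> least_card P = |A|" and "\<And>B. P B \<Longrightarrow> least_card P \<le>o |B|"
    unfolding least_card_def by blast+
qed

definition card_min :: "'a rel \<Rightarrow> 'a rel \<Rightarrow> 'a rel" where
  "card_min r s = (if r \<le>o s then r else s)"


definition Z_omega :: "(nat \<Rightarrow> int) monoid" where
  "Z_omega = product_group UNIV (\<lambda>_. integer_group)"

definition unit_vector :: "nat \<Rightarrow> nat \<Rightarrow> int" where
  "unit_vector n = (\<lambda>i. if i = n then 1 else 0)"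

definition specker_eda_number :: "(nat \<Rightarrow> int) rel" where
  "specker_eda_number = least_card (\<lambda>G.
     subgroup G Z_omega \<and> (\<forall>n. unit_vector n \<in> G) \<and>
     (\<forall>h \<in> hom (Z_omega\<lparr>carrier := G\<rparr>) integer_group.
        \<forall>\<^sub>\<infinity>n. h (unit_vector n) = 0))"


definition unbounding_number :: "(nat \<Rightarrow> nat) rel" where
  "unbounding_number = least_card (\<lambda>F. \<forall>g. \<exists>f\<in>F. \<exists>\<^sub>\<infinity>n. f n > g n)"


text \<open>
  A predictor is a pair \<open>(D, \<pi>)\<close>. The set \<open>S\<^sup>n\<close> is \<open>carrier_vec n\<close> over the type \<open>'s\<close>, and
  the restriction of \<open>f\<close> to \<open>n\<close> is \<open>vec n f\<close>; the values of \<open>\<pi> n\<close> for \<open>n \<notin> D\<close> or outside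
  \<open>carrier_vec n\<close> are never used.
\<close>

type_synonym 's predictor = "nat set \<times> (nat \<Rightarrow> 's vec \<Rightarrow> 's)"

definition is_predictor :: "'s predictor \<Rightarrow> bool" where
  "is_predictor = (\<lambda>(D, \<pi>). infinite D)"

definition predicts :: "'s predictor \<Rightarrow> (nat \<Rightarrow> 's) \<Rightarrow> bool" where
  "predicts = (\<lambda>(D, \<pi>) f. \<forall>\<^sub>\<infinity>n. n \<in> D \<longrightarrow> f n = \<pi> n (vec n f))"

definition evasion_number :: "(nat \<Rightarrow> nat) rel" where
  "evasion_number = least_card (\<lambda>F. \<nexists>P. is_predictor P \<and> (\<forall>f\<in>F. predicts P f))"


definition Q_linear :: "nat \<Rightarrow> (rat vec \<Rightarrow> rat) \<Rightarrow> bool" where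
  "Q_linear n L \<longleftrightarrow>
     (\<forall>x \<in> carrier_vec n. \<forall>y \<in> carrier_vec n. L (x + y) = L x + L y) \<and>
     (\<forall>c. \<forall>x \<in> carrier_vec n. L (c \<cdot>\<^sub>v x) = c * L x)"

type_synonym linear_predictor = "nat set \<times> (nat \<Rightarrow> int vec \<Rightarrow> rat)"

definition is_linear_predictor :: "linear_predictor \<Rightarrow> bool" where
  "is_linear_predictor = (\<lambda>(D, \<pi>). infinite D \<and>
     (\<forall>n\<in>D. \<exists>L. Q_linear n L \<and> (\<forall>x \<in> carrier_vec n. \<pi> n x = L (map_vec rat_of_int x))))"

definition linearly_predicts :: "linear_predictor \<Rightarrow> (nat \<Rightarrow> int) \<Rightarrow> bool" where
  "linearly_predicts = (\<lambda>(D, \<pi>) f. \<forall>\<^sub>\<infinity>n. n \<in> D \<longrightarrow> rat_of_int (f n) = \<pi> n (vec n f))"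

definition linear_evasion_number :: "(nat \<Rightarrow> int) rel" where
  "linear_evasion_number =
     least_card (\<lambda>F. \<nexists>P. is_linear_predictor P \<and> (\<forall>f\<in>F. linearly_predicts P f))"

end

theory Submission
  imports
    Defs
    "HOL-Algebra.Free_Abelian_Groups"
    "HOL-Computational_Algebra.Euclidean_Algorithm"
begin

text \<open>
  The proof runs through \<open>min {e, b} \<le> e\<^sub>\<ell> \<le> se \<le> min {e, b}\<close>.

  A family smaller than \<open>b\<close> is bounded by some \<open>g\<close>, so there are only finitely many candidates for
  the initial segments of its members. Cutting \<open>\<omega>\<close> into blocks longer than the number of these
  candidates, a predictor for whole blocks leaves so few possible blocks that a nonzero linear
  functional annihilates them all; this is a linear prediction.

  If a group \<open>G\<close> containing the unit vectors is linearly predicted, then its elements are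
  annihilated by almost all of a sequence of integral functionals with distinct leading positions.
  The sum of a sparse subsequence of these is a homomorphism on \<open>G\<close> that is nonzero on infinitely
  many unit vectors.

  For \<open>se \<le> b\<close>, Specker's argument with the vectors \<open>(\<Prod>j<i. f j)\<^sub>i\<close>, for monotone \<open>f\<close> from an
  unbounded family, needs growth of \<open>f\<close> only on infinitely many stretches. If \<open>e < b\<close>, an evading
  family is bounded, and its members \<open>f\<close> are turned into vectors \<open>(2 ^ t i * f i)\<^sub>i\<close>, with digits
  \<open>f i < 2 ^ (t (i + 1) - t i)\<close>. Suppose a homomorphism \<open>h\<close> is nonzero on infinitely many unit
  vectors. The value of \<open>h\<close> at such a vector is a single integer, hence known modulo \<open>2 ^ t i\<close> and
  so exactly from \<open>f\<close> below \<open>i\<close> for large \<open>i\<close>; and at those \<open>i\<close> where the 2-adic valuation of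
  \<open>h (e\<^sub>i)\<close> is minimal among all later ones, it determines \<open>f i\<close>. So \<open>h\<close> would predict the family.
\<close>

definition specker_group :: "(nat \<Rightarrow> int) set \<Rightarrow> bool" where
  "specker_group G \<longleftrightarrow> subgroup G Z_omega \<and> (\<forall>n. unit_vector n \<in> G) \<and>
     (\<forall>h \<in> hom (Z_omega\<lparr>carrier := G\<rparr>) integer_group. \<forall>\<^sub>\<infinity>n. h (unit_vector n) = 0)"

definition unbounded_family :: "(nat \<Rightarrow> nat) set \<Rightarrow> bool" where
  "unbounded_family F \<longleftrightarrow> (\<forall>g. \<exists>f\<in>F. \<exists>\<^sub>\<infinity>n. f n > g n)"

definition evading :: "(nat \<Rightarrow> 's) set \<Rightarrow> bool" where
  "evading F \<longleftrightarrow> (\<nexists>P. is_predictor P \<and> (\<forall>f\<in>F. predicts P f))"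

definition linearly_evading :: "(nat \<Rightarrow> int) set \<Rightarrow> bool" where
  "linearly_evading F \<longleftrightarrow> (\<nexists>P. is_linear_predictor P \<and> (\<forall>f\<in>F. linearly_predicts P f))"

section \<open>Subgroups of the Baer-Specker group\<close>

lemma carrier_Z_omega [simp]: "carrier Z_omega = UNIV"
  by (auto simp: Z_omega_def)

lemma one_Z_omega [simp]: "\<one>\<^bsub>Z_omega\<^esub> = (\<lambda>i. 0)"
  by (auto simp: Z_omega_def)

lemma mult_Z_omega [simp]: "x \<otimes>\<^bsub>Z_omega\<^esub> y = (\<lambda>i. x i + y i)"
  by (auto simp: Z_omega_def)

lemma group_Z_omega: "group Z_omega"
  by (simp add: Z_omega_def)

lemma inv_Z_omega [simp]: "inv\<^bsub>Z_omega\<^esub> x = (\<lambda>i. - x i)"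
  by (rule group.inv_equality[OF group_Z_omega]) auto

lemma hom_Z_omega_iff:
  "h \<in> hom (Z_omega\<lparr>carrier := G\<rparr>) integer_group \<longleftrightarrow>
     (\<forall>x\<in>G. \<forall>y\<in>G. h (\<lambda>i. x i + y i) = h x + h y)"
  by (auto simp: hom_def)

lemma hom_Z_omega_add:
  assumes "h \<in> hom (Z_omega\<lparr>carrier := G\<rparr>) integer_group" "x \<in> G" "y \<in> G"
  shows "h (\<lambda>i. x i + y i) = h x + h y"
  using assms unfolding hom_Z_omega_iff by simp

lemma subgroup_Z_omega_smult:
  assumes "subgroup G Z_omega" "x \<in> G"
  shows "(\<lambda>i. int c * x i) \<in> G"
proof (induction c)
  case 0
  show ?case using subgroup.one_closed[OF assms(1)] by simp
next
  case (Suc c)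
  show ?case using subgroup.m_closed[OF assms(1) assms(2) Suc] by (simp add: algebra_simps)
qed

lemma hom_Z_omega_smult:
  assumes G: "subgroup G Z_omega" "x \<in> G"
    and h: "h \<in> hom (Z_omega\<lparr>carrier := G\<rparr>) integer_group"
  shows "h (\<lambda>i. int c * x i) = int c * h x"
proof (induction c)
  case 0
  have "h (\<lambda>i. 0 + 0) = h (\<lambda>i. 0) + h (\<lambda>i. 0)"
    by (rule hom_Z_omega_add[OF h]) (use subgroup.one_closed[OF G(1)] in simp_all)
  then show ?case by simp
next
  case (Suc c)
  have "h (\<lambda>i. x i + int c * x i) = h x + h (\<lambda>i. int c * x i)"
    by (rule hom_Z_omega_add[OF h G(2) subgroup_Z_omega_smult[OF G]])
  then show ?case using Suc by (simp add: algebra_simps)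
qed

lemma ex_subgroup_Z_omega_card_le:
  fixes Y :: "(nat \<Rightarrow> int) set" and F :: "'a set"
  assumes F: "infinite F" and Y: "|Y| \<le>o |F|"
  shows "\<exists>G. subgroup G Z_omega \<and> Y \<subseteq> G \<and> |G| \<le>o |F|"
proof -
  \<comment> \<open>Lists with repetitions code integer combinations: concatenation gives sums,
    negated coefficients give inverses, and an infinite set has as many finite lists as
    elements.\<close>
  define \<sigma> :: "(int \<times> (nat \<Rightarrow> int)) list \<Rightarrow> nat \<Rightarrow> int"
    where "\<sigma> l = (\<lambda>i. \<Sum>(k, y)\<leftarrow>l. k * y i)" for l
  define G where "G = \<sigma> ` lists (UNIV \<times> Y)"
  have "subgroup G Z_omega"
  proof (rule group.subgroupI[OF group_Z_omega])
    show "G \<subseteq> carrier Z_omega" by simp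
    show "G \<noteq> {}" unfolding G_def by auto
    show "inv\<^bsub>Z_omega\<^esub> x \<in> G" if x: "x \<in> G" for x
    proof -
      obtain l where l: "l \<in> lists (UNIV \<times> Y)" "x = \<sigma> l" using x unfolding G_def by auto
      have "(\<lambda>i. - \<sigma> l i) = \<sigma> (map (\<lambda>(k, y). (- k, y)) l)"
        unfolding \<sigma>_def by (rule ext, induction l) auto
      moreover have "map (\<lambda>(k, y). (- k, y)) l \<in> lists (UNIV \<times> Y)" using l(1) by auto
      ultimately show ?thesis unfolding G_def l(2) by simp
    qed
    show "x \<otimes>\<^bsub>Z_omega\<^esub> y \<in> G" if xy: "x \<in> G" "y \<in> G" for x y
    proof -
      obtain l l' where l: "l \<in> lists (UNIV \<times> Y)" "x = \<sigma> l" "l' \<in> lists (UNIV \<times> Y)" "y = \<sigma> l'"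
        using xy unfolding G_def by blast
      have "(\<lambda>i. x i + y i) = \<sigma> (l @ l')" unfolding l \<sigma>_def by simp
      moreover have "l @ l' \<in> lists (UNIV \<times> Y)" using l by simp
      ultimately show ?thesis unfolding G_def by simp
    qed
  qed
  moreover have "Y \<subseteq> G"
  proof
    fix y assume "y \<in> Y"
    then have "[(1, y)] \<in> lists (UNIV \<times> Y)" "y = \<sigma> [(1, y)]" by (auto simp: \<sigma>_def)
    then show "y \<in> G" unfolding G_def by blast
  qed
  moreover have "|G| \<le>o |F|"
  proof -
    have "|UNIV :: int set| \<le>o |UNIV :: nat set|"
      by (rule card_of_ordLeqI[of to_nat]) (auto intro: inj_to_nat)
    moreover have "|UNIV :: nat set| \<le>o |F|" using F infinite_iff_card_of_nat by blast
    ultimately have "|UNIV :: int set| \<le>o |F|" by (rule ordLeq_transitive)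
    then have "|(UNIV :: int set) \<times> Y| \<le>o |F|"
      using card_of_Times_ordLeq_infinite[OF F _ Y] by blast
    then have "|lists ((UNIV :: int set) \<times> Y)| \<le>o |lists F|" by (rule card_of_lists_mono)
    also have "|lists F| =o |F|" using F by (rule card_of_lists_infinite)
    finally have "|lists ((UNIV :: int set) \<times> Y)| \<le>o |F|" .
    then show ?thesis unfolding G_def using card_of_image ordLeq_transitive by blast
  qed
  ultimately show ?thesis by blast
qed

text \<open>For nonzero \<open>q\<close>, this is the tail from \<open>n\<close> on of the vector
  with entries \<open>a i\<close> times the product of \<open>q j\<close> over \<open>j < i\<close>,
  divided by the product over \<open>j < n\<close>. These quotients are put into the group
  explicitly, since a subgroup need not be closed under such division.\<close>

definition weighted_tail :: "(nat \<Rightarrow> int) \<Rightarrow> (nat \<Rightarrow> nat) \<Rightarrow> nat \<Rightarrow> nat \<Rightarrow> int" where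
  "weighted_tail a q n = (\<lambda>i. if i < n then 0 else a i * (\<Prod>j = n..<i. int (q j)))"

lemma weighted_tail_rec:
  "weighted_tail a q n =
     (\<lambda>i. (if i = n then a n else 0) + int (q n) * weighted_tail a q (Suc n) i)"
proof
  fix i
  show "weighted_tail a q n i =
     (if i = n then a n else 0) + int (q n) * weighted_tail a q (Suc n) i"
    by (cases "n < i") (auto simp: weighted_tail_def prod.atLeast_Suc_lessThan)
qed

text \<open>Later arguments see \<open>h\<close> only through this integer recurrence, in which the
  values at unit vectors are the inhomogeneous terms.\<close>

lemma hom_weighted_tail_rec:
  assumes G: "subgroup G Z_omega" "\<And>n. unit_vector n \<in> G"
    and T: "\<And>n. weighted_tail (\<lambda>i. int (a i)) q n \<in> G"
    and h: "h \<in> hom (Z_omega\<lparr>carrier := G\<rparr>) integer_group"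
  shows "h (weighted_tail (\<lambda>i. int (a i)) q n) =
    int (a n) * h (unit_vector n) + int (q n) * h (weighted_tail (\<lambda>i. int (a i)) q (Suc n))"
proof -
  let ?T = "weighted_tail (\<lambda>i. int (a i)) q"
  have "h (?T n) = h (\<lambda>i. int (a n) * unit_vector n i + int (q n) * ?T (Suc n) i)"
    by (rule arg_cong[where f = h], subst weighted_tail_rec) (auto simp: unit_vector_def)
  also have "\<dots> = h (\<lambda>i. int (a n) * unit_vector n i) + h (\<lambda>i. int (q n) * ?T (Suc n) i)"
    by (rule hom_Z_omega_add[OF h]) (rule subgroup_Z_omega_smult[OF G(1)], rule G(2) T)+
  also have "h (\<lambda>i. int (a n) * unit_vector n i) = int (a n) * h (unit_vector n)"
    by (rule hom_Z_omega_smult[OF G(1) G(2) h])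
  also have "h (\<lambda>i. int (q n) * ?T (Suc n) i) = int (q n) * h (?T (Suc n))"
    by (rule hom_Z_omega_smult[OF G(1) T h])
  finally show ?thesis .
qed

text \<open>Countably many tails for each member of an infinite \<open>F\<close> do not raise the
  cardinality, nor does closing under integer combinations.\<close>

lemma ex_subgroup_weighted_tails:
  fixes F :: "'a set" and a q :: "'a \<Rightarrow> nat \<Rightarrow> nat"
  assumes F: "infinite F"
  shows "\<exists>G. subgroup G Z_omega \<and> (\<forall>n. unit_vector n \<in> G) \<and>
     (\<forall>f\<in>F. \<forall>n. weighted_tail (\<lambda>i. int (a f i)) (q f) n \<in> G) \<and> |G| \<le>o |F|"
proof -
  define T where "T = (\<lambda>(f, n). weighted_tail (\<lambda>i. int (a f i)) (q f) n)"
  have nat: "|UNIV :: nat set| \<le>o |F|" using F infinite_iff_card_of_nat by blast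
  have "|F \<times> (UNIV :: nat set)| \<le>o |F|"
    by (rule card_of_Times_ordLeq_infinite[OF F ordLeq_refl[OF card_of_Card_order] nat])
  then have "|T ` (F \<times> UNIV)| \<le>o |F|" using card_of_image ordLeq_transitive by blast
  moreover have "|range unit_vector| \<le>o |F|" using nat card_of_image ordLeq_transitive by blast
  ultimately have "|range unit_vector \<union> T ` (F \<times> UNIV)| \<le>o |F|"
    using card_of_Un_ordLeq_infinite[OF F] by blast
  from ex_subgroup_Z_omega_card_le[OF F this] obtain G
    where "subgroup G Z_omega" "range unit_vector \<union> T ` (F \<times> UNIV) \<subseteq> G" "|G| \<le>o |F|" by blast
  then show ?thesis by (intro exI[of _ G]) (force simp: T_def)
qed

section \<open>Unbounded families give Specker groups\<close>

text \<open>The pointwise sum of a finite family bounds each member. Infinity of \<open>F\<close> is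
  what absorbs the unit vectors and tails.\<close>

lemma unbounded_family_infinite:
  assumes "unbounded_family F"
  shows "infinite F"
proof
  assume fin: "finite F"
  obtain f where f: "f \<in> F" "\<exists>\<^sub>\<infinity>n. f n > (\<Sum>f\<in>F. f n)"
    using assms[unfolded unbounded_family_def, rule_format, of "\<lambda>n. \<Sum>f\<in>F. f n"] by blast
  have "f n \<le> (\<Sum>f\<in>F. f n)" for n using fin f(1) by (intro member_le_sum) auto
  then have "\<not> f n > (\<Sum>f\<in>F. f n)" for n by (simp only: not_less)
  then show False using f(2) by simp
qed

lemma recurrence_bound:
  fixes H k :: "nat \<Rightarrow> int" and q :: "nat \<Rightarrow> nat"
  assumes rec: "\<And>n. H n = k n + int (q n) * H (Suc n)" and q: "\<And>n. q n \<ge> 1"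
  shows "\<bar>H n\<bar> \<le> \<bar>H 0\<bar> + (\<Sum>i<n. \<bar>k i\<bar>)"
proof (induction n)
  case (Suc n)
  have "\<bar>H (Suc n)\<bar> \<le> int (q n) * \<bar>H (Suc n)\<bar>"
    using q[of n] by (simp add: mult_le_cancel_right1)
  also have "\<dots> = \<bar>H n - k n\<bar>" using rec[of n] by (simp add: abs_mult)
  also have "\<dots> \<le> \<bar>H n\<bar> + \<bar>k n\<bar>" by simp
  finally show ?case using Suc by simp
qed simp

text \<open>A nonzero integer \<open>H (Suc n)\<close> would make \<open>H n - k n\<close> at least
  \<open>q n\<close> in absolute value, more than \<open>recurrence_bound\<close> allows.\<close>

lemma recurrence_eq_0:
  fixes H k :: "nat \<Rightarrow> int" and q :: "nat \<Rightarrow> nat"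
  assumes rec: "\<And>n. H n = k n + int (q n) * H (Suc n)" and q: "\<And>n. q n \<ge> 1"
    and large: "int (q n) > \<bar>H 0\<bar> + (\<Sum>i\<le>n. \<bar>k i\<bar>)"
  shows "H (Suc n) = 0"
proof (rule ccontr)
  assume "H (Suc n) \<noteq> 0"
  then have "1 \<le> \<bar>H (Suc n)\<bar>" by linarith
  then have "int (q n) \<le> int (q n) * \<bar>H (Suc n)\<bar>" using mult_left_mono by fastforce
  also have "\<dots> = \<bar>H n - k n\<bar>" using rec[of n] by (simp add: abs_mult)
  also have "\<dots> \<le> \<bar>H n\<bar> + \<bar>k n\<bar>" by simp
  also have "\<dots> \<le> \<bar>H 0\<bar> + (\<Sum>i\<le>n. \<bar>k i\<bar>)"
    using recurrence_bound[of H k q n, OF rec q] by (simp add: lessThan_Suc_atMost[symmetric])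
  finally show False using large by simp
qed

lemma unbounded_family_specker_group:
  assumes F: "unbounded_family F"
  shows "\<exists>G. specker_group G \<and> |G| \<le>o |F|"
proof -
  \<comment> \<open>Partial sums make \<open>q f\<close> monotone and at least \<open>f\<close>; the
    successor makes it positive.\<close>
  define q :: "(nat \<Rightarrow> nat) \<Rightarrow> nat \<Rightarrow> nat" where "q f n = Suc (\<Sum>i\<le>n. f i)" for f n
  obtain G where G: "subgroup G Z_omega" "\<And>n. unit_vector n \<in> G"
      "\<And>f n. f \<in> F \<Longrightarrow> weighted_tail (\<lambda>i. int 1) (q f) n \<in> G" "|G| \<le>o |F|"
    using ex_subgroup_weighted_tails[OF unbounded_family_infinite[OF F], of "\<lambda>_ _. 1" q] by auto
  have "\<forall>\<^sub>\<infinity>n. h (unit_vector n) = 0"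
    if h: "h \<in> hom (Z_omega\<lparr>carrier := G\<rparr>) integer_group" for h
  proof (rule ccontr)
    define k where "k n = h (unit_vector n)" for n
    assume "\<not> (\<forall>\<^sub>\<infinity>n. h (unit_vector n) = 0)"
    then have "\<forall>n. \<exists>c>n. k c \<noteq> 0"
      unfolding k_def not_MOST INFM_nat by simp
    then obtain c where c: "\<And>n. c n > n" "\<And>n. k (c n) \<noteq> 0" by metis
    \<comment> \<open>The number \<open>H 0\<close> depends on \<open>f\<close> and cannot enter the
      function to be exceeded; the summand \<open>n\<close> stands in for it, passing
      \<open>\<bar>H 0\<bar>\<close> for large \<open>n\<close>.\<close>
    obtain f where f: "f \<in> F" "\<exists>\<^sub>\<infinity>n. f n > n + (\<Sum>i\<le>c n. nat \<bar>k i\<bar>)"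
      using F[unfolded unbounded_family_def, rule_format, of "\<lambda>n. n + (\<Sum>i\<le>c n. nat \<bar>k i\<bar>)"]
      by blast
    define H where "H n = h (weighted_tail (\<lambda>i. int 1) (q f) n)" for n
    have rec: "H n = k n + int (q f n) * H (Suc n)" for n
      using hom_weighted_tail_rec[OF G(1,2) G(3)[OF f(1)] h, of n] unfolding H_def k_def by simp
    have q: "q f n \<ge> 1" for n by (simp add: q_def)
    obtain n where n: "n > nat \<bar>H 0\<bar>" "f n > n + (\<Sum>i\<le>c n. nat \<bar>k i\<bar>)"
      using f(2) unfolding INFM_nat by blast
    \<comment> \<open>Since \<open>q f\<close> is monotone, one large value of \<open>f\<close> at \<open>n\<close> covers the whole stretch up to
      the next index \<open>c n\<close> at which \<open>k\<close> does not vanish.\<close>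
    have zero: "H (Suc m) = 0" if m: "n \<le> m" "m \<le> c n" for m
    proof (rule recurrence_eq_0[of H k "q f", OF rec q])
      have "(\<Sum>i\<le>m. \<bar>k i\<bar>) \<le> (\<Sum>i\<le>c n. \<bar>k i\<bar>)" using m(2) by (intro sum_mono2) auto
      moreover have "(\<Sum>i\<le>c n. \<bar>k i\<bar>) = int (\<Sum>i\<le>c n. nat \<bar>k i\<bar>)" by simp
      moreover have "f n \<le> q f m"
        unfolding q_def using m(1) by (intro le_SucI member_le_sum) auto
      ultimately show "int (q f m) > \<bar>H 0\<bar> + (\<Sum>i\<le>m. \<bar>k i\<bar>)" using n by linarith
    qed
    \<comment> \<open>As \<open>n < c n\<close>, both \<open>c n - 1\<close> and \<open>c n\<close>
      lie in the stretch, so the recurrence at \<open>c n\<close> forces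
      \<open>k (c n) = 0\<close>.\<close>
    have "H (c n) = 0" using zero[of "c n - 1"] c(1)[of n] by simp
    moreover have "H (Suc (c n)) = 0" using zero[of "c n"] c(1)[of n] by simp
    ultimately show False using rec[of "c n"] c(2)[of n] by simp
  qed
  then show ?thesis using G unfolding specker_group_def by blast
qed

section \<open>Bounded evading families give Specker groups\<close>

text \<open>The condition \<open>Q n\<close> selects the members for which position \<open>n\<close>
  must be guessed correctly. The guess copies any selected member with the given initial segment,
  and \<open>eq\<close> makes the choice immaterial.\<close>

lemma not_evadingI:
  assumes D: "infinite D"
    and Q: "\<And>f. f \<in> F \<Longrightarrow> \<forall>\<^sub>\<infinity>n. n \<in> D \<longrightarrow> Q n f"
    and eq: "\<And>n f f'. \<lbrakk>n \<in> D; f \<in> F; f' \<in> F; Q n f; Q n f'; \<And>j. j < n \<Longrightarrow> f j = f' j\<rbrakk> \<Longrightarrow> f n = f' n"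
  shows "\<not> evading F"
proof -
  define R where "R n s f \<longleftrightarrow> f \<in> F \<and> Q n f \<and> vec n f = s" for n s f
  define \<pi> where "\<pi> n s = (SOME f. R n s f) n" for n s
  have "predicts (D, \<pi>) f" if f: "f \<in> F" for f
    unfolding predicts_def prod.case
  proof (rule MOST_mono[OF Q[OF f]], intro impI)
    fix n assume "n \<in> D \<longrightarrow> Q n f" "n \<in> D"
    then have n: "n \<in> D" "Q n f" by auto
    define f' where "f' = (SOME f'. R n (vec n f) f')"
    have "R n (vec n f) f" using f n by (simp add: R_def)
    then have "R n (vec n f) f'" unfolding f'_def by (rule someI[of "R n (vec n f)"])
    then have f': "f' \<in> F" "Q n f'" "vec n f' = vec n f" by (auto simp: R_def)
    have "f j = f' j" if "j < n" for j
      using that f'(3) by (metis index_vec)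
    then have "f n = f' n" using eq n f f' by blast
    then show "f n = \<pi> n (vec n f)" by (simp add: \<pi>_def f'_def)
  qed
  moreover have "is_predictor (D, \<pi>)" using D by (simp add: is_predictor_def)
  ultimately show ?thesis unfolding evading_def by blast
qed

text \<open>Finitely many sequences are told apart by some finite initial segment, which then
  determines all later values.\<close>

lemma evading_infinite:
  assumes "evading F"
  shows "infinite F"
proof
  assume fin: "finite F"
  define Q where "Q n f \<longleftrightarrow> (\<forall>f'\<in>F. (\<forall>j<n. f j = f' j) \<longrightarrow> f = f')" for n and f :: "nat \<Rightarrow> 'a"
  have "\<forall>\<^sub>\<infinity>n. \<forall>f'\<in>F. (\<forall>j<n. f j = f' j) \<longrightarrow> f = f'" for f :: "nat \<Rightarrow> 'a"
  proof -
    have "\<forall>\<^sub>\<infinity>n. (\<forall>j<n. f j = f' j) \<longrightarrow> f = f'" for f'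
    proof (cases "f = f'")
      case False
      then obtain j where "f j \<noteq> f' j" by blast
      then show ?thesis unfolding MOST_nat by blast
    qed simp
    then show ?thesis using fin by (simp add: eventually_ball_finite)
  qed
  then have ev: "\<forall>\<^sub>\<infinity>n. n \<in> UNIV \<longrightarrow> Q n f" for f by (simp add: Q_def)
  have "\<not> evading F"
  proof (rule not_evadingI[OF infinite_UNIV_nat ev])
    fix n f f' assume "Q n f" "f' \<in> F" "\<And>j. j < n \<Longrightarrow> f j = f' j"
    then have "f = f'" unfolding Q_def by blast
    then show "f n = f' n" by simp
  qed
  then show False using assms by blast
qed

text \<open>The recurrence only looks upward, so the induction is on the exponent, for all
  \<open>n\<close> at once: the even factor \<open>q n\<close> adds a factor 2 to those of
  \<open>\<Delta> (Suc n)\<close>, and \<open>k n\<close> has enough of them up to exponent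
  \<open>v\<close>.\<close>

lemma dvd_2_power_recurrence:
  fixes \<Delta> :: "nat \<Rightarrow> int"
  assumes rec: "\<And>n. \<Delta> n = \<delta> n * k n + q n * \<Delta> (Suc n)" and q: "\<And>n. 2 dvd q n"
    and k: "\<And>n. n \<ge> i \<Longrightarrow> 2 ^ v dvd k n"
  shows "n \<ge> i \<Longrightarrow> 2 ^ v dvd \<Delta> n"
proof -
  have "u \<le> v \<Longrightarrow> n \<ge> i \<Longrightarrow> 2 ^ u dvd \<Delta> n" for u n
  proof (induction u arbitrary: n)
    case (Suc u)
    have "2 ^ Suc u dvd k n" using k[OF Suc.prems(2)] Suc.prems(1) power_le_dvd by blast
    moreover have "2 ^ Suc u dvd q n * \<Delta> (Suc n)"
      using mult_dvd_mono[OF q[of n] Suc.IH[of "Suc n"]] Suc.prems by simp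
    ultimately show ?case by (subst rec) (simp only: dvd_add dvd_mult)
  qed simp
  then show "n \<ge> i \<Longrightarrow> 2 ^ v dvd \<Delta> n" by blast
qed

text \<open>Beyond any \<open>N\<close>, a nonzero \<open>k i\<close> of least 2-adic valuation
  gives such an index; vanishing later values are divisible by every power.\<close>

lemma infinite_minimal_2_valuation:
  fixes k :: "nat \<Rightarrow> int"
  assumes k: "\<exists>\<^sub>\<infinity>n. k n \<noteq> 0"
  shows "infinite {i. \<exists>v. (\<forall>j\<ge>i. 2 ^ v dvd k j) \<and> \<not> 2 ^ Suc v dvd k i}"
  unfolding infinite_nat_iff_unbounded_le
proof
  fix N
  obtain i0 where "i0 \<ge> N \<and> k i0 \<noteq> 0" using k unfolding INFM_nat_le by blast
  from exists_least_iff[of "\<lambda>v. \<exists>i\<ge>N. k i \<noteq> 0 \<and> v = multiplicity 2 (k i)"] this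
  obtain i where i: "i \<ge> N" "k i \<noteq> 0"
    and least: "\<And>j. j \<ge> N \<Longrightarrow> k j \<noteq> 0 \<Longrightarrow> multiplicity 2 (k i) \<le> multiplicity 2 (k j)"
    by (metis not_less)
  have "2 ^ multiplicity 2 (k i) dvd k j" if "j \<ge> i" for j
  proof (cases "k j = 0")
    case False
    then show ?thesis using least[of j] that i(1) by (intro multiplicity_dvd') auto
  qed simp
  moreover have "\<not> 2 ^ Suc (multiplicity 2 (k i)) dvd k i"
    using power_dvd_iff_le_multiplicity[OF i(2), of 2 "Suc (multiplicity 2 (k i))"] by simp
  ultimately show "\<exists>n\<ge>N. n \<in> {i. \<exists>v. (\<forall>j\<ge>i. 2 ^ v dvd k j) \<and> \<not> 2 ^ Suc v dvd k i}"
    using i(1) by blast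
qed

lemma recurrence_determines_digit:
  fixes H H' k :: "nat \<Rightarrow> int" and f f' b :: "nat \<Rightarrow> nat"
  assumes rec: "\<And>n. H n = int (f n) * k n + 2 ^ Suc (b n) * H (Suc n)"
    and rec': "\<And>n. H' n = int (f' n) * k n + 2 ^ Suc (b n) * H' (Suc n)"
    and small: "2 * \<bar>H 0\<bar> < 2 ^ i" "2 * \<bar>H' 0\<bar> < 2 ^ i"
    and digit: "f i \<le> b i" "f' i \<le> b i"
    and v: "\<And>j. j \<ge> i \<Longrightarrow> 2 ^ v dvd k j" "\<not> 2 ^ Suc v dvd k i"
    and agree: "\<And>j. j < i \<Longrightarrow> f j = f' j"
  shows "f i = f' i"
proof -
  define \<Delta> where "\<Delta> n = H n - H' n" for n
  define \<delta> where "\<delta> n = int (f n) - int (f' n)" for n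
  have \<Delta>: "\<Delta> n = \<delta> n * k n + 2 ^ Suc (b n) * \<Delta> (Suc n)" for n
    unfolding \<Delta>_def \<delta>_def rec[of n] rec'[of n] by (simp add: algebra_simps)
  \<comment> \<open>As long as the digits agree, each step divides the difference by an even number,
    so at \<open>i\<close> its absolute value is below 1 and it vanishes.\<close>
  have "m \<le> i \<Longrightarrow> 2 ^ m * \<bar>\<Delta> m\<bar> \<le> \<bar>\<Delta> 0\<bar>" for m
  proof (induction m)
    case (Suc m)
    have "\<Delta> m = 2 ^ Suc (b m) * \<Delta> (Suc m)"
      using \<Delta>[of m] agree[of m] Suc.prems by (simp add: \<delta>_def)
    then have "\<bar>\<Delta> m\<bar> = 2 * (2 ^ b m * \<bar>\<Delta> (Suc m)\<bar>)" by (simp add: abs_mult)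
    moreover have "\<bar>\<Delta> (Suc m)\<bar> \<le> 2 ^ b m * \<bar>\<Delta> (Suc m)\<bar>"
      by (simp add: mult_le_cancel_right1)
    ultimately have "2 * \<bar>\<Delta> (Suc m)\<bar> \<le> \<bar>\<Delta> m\<bar>" by linarith
    then have "2 ^ m * (2 * \<bar>\<Delta> (Suc m)\<bar>) \<le> 2 ^ m * \<bar>\<Delta> m\<bar>"
      by (rule mult_left_mono) simp
    also have "\<dots> \<le> \<bar>\<Delta> 0\<bar>" using Suc by simp
    finally show ?case by (simp add: mult.assoc mult.left_commute)
  qed simp
  then have "2 ^ i * \<bar>\<Delta> i\<bar> \<le> \<bar>\<Delta> 0\<bar>" by simp
  also have "\<dots> < 2 ^ i * 1" using small unfolding \<Delta>_def by linarith
  finally have "\<bar>\<Delta> i\<bar> < 1" by (subst (asm) mult_less_cancel_left_pos) auto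
  then have 0: "\<delta> i * k i = - (2 ^ Suc (b i) * \<Delta> (Suc i))" using \<Delta>[of i] by linarith
  have "2 ^ v dvd \<Delta> (Suc i)"
    by (rule dvd_2_power_recurrence[of \<Delta> \<delta> k "\<lambda>n. 2 ^ Suc (b n)" i, OF \<Delta> _ v(1)]) auto
  \<comment> \<open>\<open>k i\<close> carries exactly \<open>v\<close> factors 2, so the other
    \<open>Suc (b i)\<close> must divide the digit difference, which is too small for that unless it
    is zero.\<close>
  then have "2 ^ Suc (b i) * 2 ^ v dvd \<delta> i * k i" unfolding 0 by simp
  moreover obtain w where w: "k i = 2 ^ v * w" using v(1)[of i] by auto
  ultimately have "2 ^ Suc (b i) dvd \<delta> i * w" by (simp add: mult.commute mult.left_commute)
  moreover have "odd w" using v(2) w by auto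
  ultimately have dvd: "2 ^ Suc (b i) dvd \<delta> i"
    by (metis coprime_dvd_mult_left_iff coprime_power_left_iff coprime_left_2_iff_odd)
  have "\<bar>\<delta> i\<bar> \<le> int (b i)" using digit unfolding \<delta>_def by linarith
  also have "int (b i) < int (2 ^ Suc (b i))"
    using less_exp[of "Suc (b i)"] by linarith
  finally have "\<delta> i = 0" using dvd zdvd_imp_le[of "2 ^ Suc (b i)" "\<bar>\<delta> i\<bar>"] by force
  then show ?thesis by (simp add: \<delta>_def)
qed

lemma bounded_evading_specker_group:
  fixes F :: "(nat \<Rightarrow> nat) set"
  assumes F: "evading F" and b: "\<And>f. f \<in> F \<Longrightarrow> \<forall>\<^sub>\<infinity>n. f n \<le> b n"
  shows "\<exists>G. specker_group G \<and> |G| \<le>o |F|"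
proof -
  \<comment> \<open>The base is the same for all members of \<open>F\<close>, so the recurrences of
    two members can be subtracted; it is even and exceeds every digit up to
    \<open>b n\<close>.\<close>
  define q where "q n = (2::nat) ^ Suc (b n)" for n
  obtain G where G: "subgroup G Z_omega" "\<And>n. unit_vector n \<in> G"
      "\<And>f n. f \<in> F \<Longrightarrow> weighted_tail (\<lambda>i. int (f i)) q n \<in> G" "|G| \<le>o |F|"
    using ex_subgroup_weighted_tails[OF evading_infinite[OF F], of "\<lambda>f. f" "\<lambda>_. q"] by auto
  have "\<forall>\<^sub>\<infinity>n. h (unit_vector n) = 0"
    if h: "h \<in> hom (Z_omega\<lparr>carrier := G\<rparr>) integer_group" for h
  proof (rule ccontr)
    define k where "k n = h (unit_vector n)" for n
    define H where "H f n = h (weighted_tail (\<lambda>i. int (f i)) q n)" for f n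
    define D where "D = {i. \<exists>v. (\<forall>j\<ge>i. 2 ^ v dvd k j) \<and> \<not> 2 ^ Suc v dvd k i}"
    \<comment> \<open>The size condition on \<open>H f 0\<close> makes members that agree below
      \<open>n\<close> have equal \<open>H f n\<close>; its threshold depends on \<open>f\<close>,
      which prediction up to finitely many errors permits.\<close>
    define Q where "Q n f \<longleftrightarrow> f n \<le> b n \<and> 2 * \<bar>H f 0\<bar> < 2 ^ n" for n f
    assume "\<not> (\<forall>\<^sub>\<infinity>n. h (unit_vector n) = 0)"
    then have D: "infinite D"
      unfolding D_def by (intro infinite_minimal_2_valuation) (simp add: k_def not_MOST)
    have rec: "H f n = int (f n) * k n + 2 ^ Suc (b n) * H f (Suc n)" if "f \<in> F" for f n
    proof -
      have "int (q n) = 2 ^ Suc (b n)" by (simp add: q_def)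
      then show ?thesis
        using hom_weighted_tail_rec[OF G(1,2) G(3)[OF that] h, of n] unfolding H_def k_def
        by (simp only:)
    qed
    have "\<not> evading F"
    proof (rule not_evadingI[OF D, where Q = Q])
      fix f assume f: "f \<in> F"
      have "2 * \<bar>H f 0\<bar> < 2 ^ n" if "n \<ge> nat (2 * \<bar>H f 0\<bar>)" for n
      proof -
        have "int n < int (2 ^ n)" using less_exp[of n] by linarith
        also have "int (2 ^ n) = 2 ^ n" by simp
        finally show ?thesis using that by linarith
      qed
      then have "\<forall>\<^sub>\<infinity>n. 2 * \<bar>H f 0\<bar> < 2 ^ n" unfolding MOST_nat_le by blast
      then have "\<forall>\<^sub>\<infinity>n. Q n f" using b[OF f] unfolding Q_def by (simp add: MOST_conj_distrib)
      then show "\<forall>\<^sub>\<infinity>n. n \<in> D \<longrightarrow> Q n f" by (rule MOST_mono) simp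
    next
      fix i f f'
      assume i: "i \<in> D" and f: "f \<in> F" "f' \<in> F" "Q i f" "Q i f'"
        and agree: "\<And>j. j < i \<Longrightarrow> f j = f' j"
      obtain v where v: "\<And>j. j \<ge> i \<Longrightarrow> 2 ^ v dvd k j" "\<not> 2 ^ Suc v dvd k i"
        using i unfolding D_def by blast
      show "f i = f' i"
        by (rule recurrence_determines_digit[OF rec[OF f(1)] rec[OF f(2)] _ _ _ _ v agree])
          (use f in \<open>auto simp: Q_def\<close>)
    qed
    then show False using F by blast
  qed
  then show ?thesis using G unfolding specker_group_def by blast
qed

section \<open>Specker groups are linearly evading\<close>

lemma Q_linear_coeffs:
  assumes L: "Q_linear n L"
  shows "\<exists>c. \<forall>f. L (vec n f) = (\<Sum>j<n. c j * f j)"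
proof -
  have add: "L (x + y) = L x + L y" if "x \<in> carrier_vec n" "y \<in> carrier_vec n" for x y
    using L that unfolding Q_linear_def by blast
  have smult: "L (a \<cdot>\<^sub>v x) = a * L x" if "x \<in> carrier_vec n" for a x
    using L that unfolding Q_linear_def by blast
  have "m \<le> n \<Longrightarrow>
      L (vec n (\<lambda>i. if i < m then f i else 0)) = (\<Sum>j<m. L (unit_vec n j) * f j)" for m f
  proof (induction m)
    case 0
    have "L (0 \<cdot>\<^sub>v vec n (\<lambda>_. 0)) = 0" by (subst smult) auto
    moreover have "0 \<cdot>\<^sub>v vec n (\<lambda>_. 0 :: rat) = vec n (\<lambda>_. 0)" by auto
    ultimately show ?case by simp
  next
    case (Suc m)
    have "vec n (\<lambda>i. if i < Suc m then f i else 0) =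
        vec n (\<lambda>i. if i < m then f i else 0) + f m \<cdot>\<^sub>v unit_vec n m"
      using Suc.prems by (intro eq_vecI) (auto simp: unit_vec_def less_Suc_eq)
    then have "L (vec n (\<lambda>i. if i < Suc m then f i else 0)) =
        L (vec n (\<lambda>i. if i < m then f i else 0)) + f m * L (unit_vec n m)"
      by (simp add: add smult)
    then show ?case using Suc by (simp add: mult.commute)
  qed
  from this[of n] have "L (vec n (\<lambda>i. if i < n then f i else 0)) = (\<Sum>j<n. L (unit_vec n j) * f j)"
    for f by simp
  moreover have "vec n (\<lambda>i. if i < n then f i else 0) = vec n f" for f :: "nat \<Rightarrow> rat"
    by auto
  ultimately show ?thesis by auto
qed

lemma common_denominator:
  fixes c :: "nat \<Rightarrow> rat"
  shows "\<exists>N>0. \<exists>a. \<forall>j<n. of_int N * c j = of_int (a j)"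
proof (induction n)
  case (Suc n)
  then obtain N a where N: "N > 0" "\<And>j. j < n \<Longrightarrow> of_int N * c j = of_int (a j)" by blast
  obtain p q where pq: "c n = of_int p / of_int q" "q > 0"
    by (metis quotient_of_div quotient_of_denom_pos surj_pair)
  have "of_int (N * q) * c j = of_int (if j = n then N * p else q * a j)" if "j < Suc n" for j
    using that N(2)[of j] pq by (auto simp: less_Suc_eq mult.assoc mult.left_commute)
  then show ?case using N(1) pq(2)
    by (intro exI[of _ "N * q"] conjI exI[of _ "\<lambda>j. if j = n then N * p else q * a j"]) auto
qed (auto intro: exI[of _ 1])

text \<open>Clearing denominators and moving the prediction to the other side yields an integral
  functional with leading position \<open>n\<close>, so that finite sums of such functionals stay
  integer valued.\<close>

lemma linear_predictor_integer_relations: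
  assumes "is_linear_predictor (D, \<pi>)"
  shows "\<exists>a :: nat \<Rightarrow> nat \<Rightarrow> int. \<forall>n\<in>D. a n n \<noteq> 0 \<and>
    (\<forall>f. rat_of_int (f n) = \<pi> n (vec n f) \<longrightarrow> (\<Sum>j\<le>n. a n j * f j) = 0)"
proof (rule bchoice, rule ballI)
  fix n assume "n \<in> D"
  then obtain L where L: "Q_linear n L" "\<And>x. x \<in> carrier_vec n \<Longrightarrow> \<pi> n x = L (map_vec rat_of_int x)"
    using assms unfolding is_linear_predictor_def by blast
  obtain c where c: "\<And>f. L (vec n f) = (\<Sum>j<n. c j * f j)" using Q_linear_coeffs[OF L(1)] by blast
  obtain N a where N: "N > 0" "\<And>j. j < n \<Longrightarrow> of_int N * c j = of_int (a j)"
    using common_denominator by blast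
  have "(\<Sum>j\<le>n. (if j = n then N else - a j) * f j) = 0"
    if f: "rat_of_int (f n) = \<pi> n (vec n f)" for f :: "nat \<Rightarrow> int"
  proof -
    have "map_vec rat_of_int (vec n f) = vec n (\<lambda>i. rat_of_int (f i))" by auto
    then have "rat_of_int (f n) = (\<Sum>j<n. c j * rat_of_int (f j))"
      using f L(2)[of "vec n f"] c by simp
    then have "rat_of_int (N * f n) = (\<Sum>j<n. (of_int N * c j) * rat_of_int (f j))"
      by (simp add: sum_distrib_left mult.assoc)
    also have "\<dots> = rat_of_int (\<Sum>j<n. a j * f j)" by (simp add: N(2))
    finally have "N * f n = (\<Sum>j<n. a j * f j)" by (simp only: of_int_eq_iff)
    then show ?thesis
      by (simp add: lessThan_Suc_atMost[symmetric] sum_negf)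
  qed
  then show "\<exists>a :: nat \<Rightarrow> int. a n \<noteq> 0 \<and>
      (\<forall>f. rat_of_int (f n) = \<pi> n (vec n f) \<longrightarrow> (\<Sum>j\<le>n. a j * f j) = 0)"
    using N(1) by (intro exI[of _ "\<lambda>j. if j = n then N else - a j"]) auto
qed

text \<open>Each next element is chosen beyond the threshold after which \<open>P\<close> holds for
  the current one; later elements are larger still.\<close>

lemma infinite_thinning:
  fixes D :: "nat set"
  assumes D: "infinite D" and P: "\<And>m. \<forall>\<^sub>\<infinity>n. n \<in> D \<longrightarrow> P m n"
  shows "\<exists>D'\<subseteq>D. infinite D' \<and> (\<forall>m\<in>D'. \<forall>n\<in>D'. m < n \<longrightarrow> P m n)"
proof -
  have "\<forall>m. \<exists>B. \<forall>n\<ge>B. n \<in> D \<longrightarrow> P m n" using P unfolding MOST_nat_le by blast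
  then obtain B where B: "\<And>m n. n \<ge> B m \<Longrightarrow> n \<in> D \<Longrightarrow> P m n" by metis
  have ex: "\<exists>n\<in>D. n \<ge> N" for N using D unfolding infinite_nat_iff_unbounded_le by blast
  have "\<exists>s. \<forall>k. s k \<in> D \<and> s (Suc k) \<ge> Suc (s k) + B (s k)"
    by (rule dependent_nat_choice) (use ex in blast)+
  then obtain s where s: "\<And>k. s k \<in> D" "\<And>k. s (Suc k) \<ge> Suc (s k) + B (s k)" by blast
  have mono: "strict_mono s" unfolding strict_mono_Suc_iff
    using s(2) by (metis Suc_le_eq le_add1 order_trans)
  have "P (s j) (s k)" if "s j < s k" for j k
  proof (rule B[OF _ s(1)])
    have "Suc j \<le> k" using that mono by (simp add: strict_mono_less Suc_le_eq)
    then have "s (Suc j) \<le> s k" using mono by (simp add: strict_mono_less_eq)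
    then show "B (s j) \<le> s k" using s(2)[of j] by linarith
  qed
  moreover have "infinite (range s)" using mono strict_mono_imp_inj_on range_inj_infinite by blast
  ultimately show ?thesis using s(1) by (intro exI[of _ "range s"]) auto
qed

lemma specker_group_linearly_evading:
  assumes "specker_group G"
  shows "linearly_evading G"
  unfolding linearly_evading_def
proof
  assume "\<exists>P. is_linear_predictor P \<and> (\<forall>f\<in>G. linearly_predicts P f)"
  then obtain D \<pi> where lp: "is_linear_predictor (D, \<pi>)" "\<And>f. f \<in> G \<Longrightarrow> linearly_predicts (D, \<pi>) f"
    by auto
  obtain a :: "nat \<Rightarrow> nat \<Rightarrow> int" where a: "\<And>n. n \<in> D \<Longrightarrow> a n n \<noteq> 0"
    "\<And>n f. n \<in> D \<Longrightarrow> rat_of_int (f n) = \<pi> n (vec n f) \<Longrightarrow> (\<Sum>j\<le>n. a n j * f j) = 0"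
    using linear_predictor_integer_relations[OF lp(1)] by blast
  define \<phi> where "\<phi> n f = (\<Sum>j\<le>n. a n j * f j)" for n and f :: "nat \<Rightarrow> int"
  have D: "infinite D" using lp(1) by (simp add: is_linear_predictor_def)
  have G: "subgroup G Z_omega" "\<And>n. unit_vector n \<in> G"
    using assms unfolding specker_group_def by auto
  have \<phi>: "\<forall>\<^sub>\<infinity>n. n \<in> D \<longrightarrow> \<phi> n f = 0" if "f \<in> G" for f
    using lp(2)[OF that] unfolding linearly_predicts_def prod.case \<phi>_def
    by (rule MOST_mono) (intro impI a(2), simp_all)
  \<comment> \<open>On \<open>D'\<close> the matrix of values
    \<open>\<phi> n (unit_vector m)\<close> becomes diagonal: thinning removes the entries with
    \<open>m < n\<close>, and those with \<open>n < m\<close> vanish because \<open>\<phi> n\<close>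
    reads only positions up to \<open>n\<close>.\<close>
  obtain D' where D': "D' \<subseteq> D" "infinite D'"
    and thin: "\<And>m n. m \<in> D' \<Longrightarrow> n \<in> D' \<Longrightarrow> m < n \<Longrightarrow> \<phi> n (unit_vector m) = 0"
    using infinite_thinning[of D "\<lambda>m n. \<phi> n (unit_vector m) = 0", OF D \<phi>[OF G(2)]] by auto
  define S where "S f = {n \<in> D'. \<phi> n f \<noteq> 0}" for f
  have fin: "finite (S f)" if "f \<in> G" for f
  proof (rule finite_subset)
    show "S f \<subseteq> {n. \<not> (n \<in> D \<longrightarrow> \<phi> n f = 0)}" using D'(1) by (auto simp: S_def)
    show "finite {n. \<not> (n \<in> D \<longrightarrow> \<phi> n f = 0)}" using \<phi>[OF that] by (simp only: eventually_cofinite)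
  qed
  \<comment> \<open>This is the sum of the functionals over all of \<open>D'\<close>; on an element
    of \<open>G\<close> only finitely many terms are nonzero.\<close>
  define h where "h f = (\<Sum>n\<in>S f. \<phi> n f)" for f
  have "h \<in> hom (Z_omega\<lparr>carrier := G\<rparr>) integer_group"
    unfolding hom_Z_omega_iff
  proof (intro ballI)
    fix x y assume xy: "x \<in> G" "y \<in> G"
    let ?A = "S x \<union> S y"
    have A: "finite ?A" using xy fin by simp
    have add: "\<phi> n (\<lambda>i. x i + y i) = \<phi> n x + \<phi> n y" for n
      by (simp add: \<phi>_def distrib_left sum.distrib)
    have "h (\<lambda>i. x i + y i) = (\<Sum>n\<in>?A. \<phi> n (\<lambda>i. x i + y i))"
      unfolding h_def by (rule sum.mono_neutral_left) (simp_all only: A, auto simp: S_def add)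
    also have "\<dots> = (\<Sum>n\<in>?A. \<phi> n x) + (\<Sum>n\<in>?A. \<phi> n y)" by (simp add: add sum.distrib)
    also have "(\<Sum>n\<in>?A. \<phi> n x) = h x"
      unfolding h_def by (rule sum.mono_neutral_right) (simp_all only: A, auto simp: S_def)
    also have "(\<Sum>n\<in>?A. \<phi> n y) = h y"
      unfolding h_def by (rule sum.mono_neutral_right) (simp_all only: A, auto simp: S_def)
    finally show "h (\<lambda>i. x i + y i) = h x + h y" .
  qed
  then have zero: "\<forall>\<^sub>\<infinity>n. h (unit_vector n) = 0" using assms unfolding specker_group_def by blast
  have nonzero: "h (unit_vector m) \<noteq> 0" if m: "m \<in> D'" for m
  proof -
    have diag: "\<phi> m (unit_vector m) = a m m"
      by (simp add: \<phi>_def unit_vector_def if_distrib cong: if_cong)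
    have "\<phi> n (unit_vector m) = 0" if "n < m" for n
      using that by (simp add: \<phi>_def unit_vector_def if_distrib cong: if_cong)
    then have "S (unit_vector m) = {m}"
      using m thin diag a(1) D'(1) unfolding S_def by (auto, metis linorder_neqE_nat)
    then show ?thesis using diag a(1) m D'(1) by (auto simp: h_def)
  qed
  have "\<forall>\<^sub>\<infinity>n. n \<notin> D'" by (rule MOST_mono[OF zero]) (use nonzero in blast)
  then show False using D'(2) by (simp add: eventually_cofinite)
qed

section \<open>Linear prediction from prediction and boundedness\<close>

text \<open>Gaussian elimination: a row \<open>s\<close> with nonzero pivot \<open>u s p\<close>
  determines the unknown \<open>p\<close>, and substituting it leaves one equation and one unknown
  fewer.\<close>

lemma underdetermined_system:
  fixes u :: "'i \<Rightarrow> 'j \<Rightarrow> 'k :: field"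
  assumes "finite I" "finite J" "card I < card J"
  shows "\<exists>z. (\<exists>j\<in>J. z j \<noteq> 0) \<and> (\<forall>i\<in>I. (\<Sum>j\<in>J. z j * u i j) = 0)"
  using assms
proof (induction I arbitrary: J u rule: finite_induct)
  case empty
  then have "J \<noteq> {}" by auto
  then show ?case by (intro exI[of _ "\<lambda>_. 1"]) auto
next
  case (insert s I)
  show ?case
  proof (cases "\<forall>j\<in>J. u s j = 0")
    case True
    then show ?thesis using insert.IH[of J u] insert by auto
  next
    case False
    then obtain p where p: "p \<in> J" "u s p \<noteq> 0" by blast
    define J' where "J' = J - {p}"
    have J': "finite J'" "p \<notin> J'" "J = insert p J'" using p insert.prems by (auto simp: J'_def)
    then have "card I < card J'" using insert by simp
    from insert.IH[OF J'(1) this, of "\<lambda>i j. u i j - u i p / u s p * u s j"] obtain z where z: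
      "\<exists>j\<in>J'. z j \<noteq> 0" "\<And>i. i \<in> I \<Longrightarrow> (\<Sum>j\<in>J'. z j * (u i j - u i p / u s p * u s j)) = 0"
      by blast
    define w where "w = (\<Sum>j\<in>J'. z j * u s j)"
    define z' where "z' = z(p := - w / u s p)"
    have sum: "(\<Sum>j\<in>J. z' j * u i j) = - w / u s p * u i p + (\<Sum>j\<in>J'. z j * u i j)" for i
    proof -
      have "(\<Sum>j\<in>J'. z' j * u i j) = (\<Sum>j\<in>J'. z j * u i j)"
        by (rule sum.cong) (use J' in \<open>auto simp: z'_def\<close>)
      then show ?thesis using J' by (simp add: z'_def)
    qed
    have "(\<Sum>j\<in>J. z' j * u i j) = 0" if "i \<in> I" for i
    proof -
      have "0 = (\<Sum>j\<in>J'. z j * u i j - u i p / u s p * (z j * u s j))"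
        using z(2)[OF that] by (simp add: algebra_simps)
      also have "\<dots> = (\<Sum>j\<in>J'. z j * u i j) - u i p / u s p * w"
        by (simp add: sum_subtractf sum_distrib_left w_def)
      finally show ?thesis unfolding sum by (simp add: algebra_simps)
    qed
    moreover have "(\<Sum>j\<in>J. z' j * u s j) = 0" unfolding sum using p by (simp add: w_def)
    moreover have "\<exists>j\<in>J. z' j \<noteq> 0" using z(1) J' by (auto simp: z'_def)
    ultimately show ?thesis by blast
  qed
qed

lemma not_linearly_evadingI:
  fixes F :: "(nat \<Rightarrow> int) set" and c :: "nat \<Rightarrow> nat \<Rightarrow> rat"
  assumes D: "infinite D"
    and F: "\<And>f. f \<in> F \<Longrightarrow> \<forall>\<^sub>\<infinity>n. n \<in> D \<longrightarrow> rat_of_int (f n) = (\<Sum>j<n. c n j * rat_of_int (f j))"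
  shows "\<not> linearly_evading F"
proof -
  define \<pi> where "\<pi> n x = (\<Sum>j<n. c n j * rat_of_int (x $ j))" for n and x :: "int vec"
  have "is_linear_predictor (D, \<pi>)"
    unfolding is_linear_predictor_def prod.case
  proof (intro conjI ballI D)
    fix n
    define L where "L x = (\<Sum>j<n. c n j * x $ j)" for x
    have "Q_linear n L"
      unfolding Q_linear_def L_def
      by (auto simp: distrib_left sum.distrib sum_distrib_left mult.left_commute)
    moreover have "\<forall>x\<in>carrier_vec n. \<pi> n x = L (map_vec rat_of_int x)"
      by (auto simp: \<pi>_def L_def)
    ultimately show "\<exists>L. Q_linear n L \<and> (\<forall>x\<in>carrier_vec n. \<pi> n x = L (map_vec rat_of_int x))"
      by blast
  qed
  moreover have "linearly_predicts (D, \<pi>) f" if "f \<in> F" for f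
    using F[OF that] by (simp add: linearly_predicts_def \<pi>_def)
  ultimately show ?thesis unfolding linearly_evading_def by blast
qed

text \<open>The slack \<open>k\<close> will absorb the finitely many values of a function that
  exceed \<open>g\<close>; the sum dominates every earlier \<open>g i\<close> at once.\<close>

definition bounded_words :: "(nat \<Rightarrow> nat) \<Rightarrow> nat \<Rightarrow> nat \<Rightarrow> int list set" where
  "bounded_words g k m =
     {s. set s \<subseteq> {- int (k + (\<Sum>i<m. g i))..int (k + (\<Sum>i<m. g i))} \<and> length s = m}"

lemma finite_bounded_words: "finite (bounded_words g k m)"
  unfolding bounded_words_def by (rule finite_lists_length_eq) simp

primrec block_start :: "(nat \<Rightarrow> nat) \<Rightarrow> nat \<Rightarrow> nat" where
  "block_start g 0 = 0"
| "block_start g (Suc k) =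
     block_start g k + Suc (card (bounded_words g k (block_start g k)))"

lemma strict_mono_block_start: "strict_mono (block_start g)"
  by (simp add: strict_mono_Suc_iff)

text \<open>Evasion concerns sequences of natural numbers, so each block, a list of integers, is
  coded as one number.\<close>

definition block_code :: "(nat \<Rightarrow> nat) \<Rightarrow> (nat \<Rightarrow> int) \<Rightarrow> nat \<Rightarrow> nat" where
  "block_code g f k = to_nat (map f [block_start g k..<block_start g (Suc k)])"

lemma block_code_eq_iff:
  "block_code g f k = block_code g f' k \<longleftrightarrow>
     (\<forall>j. block_start g k \<le> j \<and> j < block_start g (Suc k) \<longrightarrow> f j = f' j)"
  unfolding block_code_def
  by (simp del: block_start.simps upt_Suc add: inj_eq[OF inj_to_nat] Ball_def)

text \<open>A block is longer than the number of bounded words preceding it, so if the word before the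
  block determines the block, then some nontrivial linear relation kills all possible blocks.\<close>

lemma block_linear_relation:
  fixes A :: "(nat \<Rightarrow> int) set"
  assumes bounded: "\<And>f. f \<in> A \<Longrightarrow> map f [0..<block_start g k] \<in> bounded_words g k (block_start g k)"
    and determined: "\<And>f f'. \<lbrakk>f \<in> A; f' \<in> A; \<And>j. j < block_start g k \<Longrightarrow> f j = f' j\<rbrakk>
      \<Longrightarrow> block_code g f k = block_code g f' k"
  shows "\<exists>n c. block_start g k \<le> n \<and> n < block_start g (Suc k) \<and>
    (\<forall>f\<in>A. rat_of_int (f n) = (\<Sum>j<n. c j * rat_of_int (f j)))"
proof -
  let ?a = "block_start g k"
  define J where "J = {?a..<block_start g (Suc k)}"
  define I where "I = (\<lambda>f. map f [0..<?a]) ` A"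
  \<comment> \<open>One member of \<open>A\<close> stands for each initial word; by
    \<open>determined\<close> the block does not depend on the choice.\<close>
  define rep where "rep = inv_into A (\<lambda>f. map f [0..<?a])"
  have I: "I \<subseteq> bounded_words g k ?a" using bounded by (auto simp: I_def)
  have "card I < card J"
    using card_mono[OF finite_bounded_words I] by (simp add: J_def)
  moreover have "finite I" by (rule finite_subset[OF I finite_bounded_words])
  moreover have "finite J" by (simp add: J_def)
  ultimately obtain z where z: "\<exists>j\<in>J. z j \<noteq> 0"
      "\<And>s. s \<in> I \<Longrightarrow> (\<Sum>j\<in>J. z j * rat_of_int (rep s j)) = 0"
    using underdetermined_system[of I J "\<lambda>s j. rat_of_int (rep s j)"] by blast
  have rel: "(\<Sum>j\<in>J. z j * rat_of_int (f j)) = 0" if f: "f \<in> A" for f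
  proof -
    let ?s = "map f [0..<?a]"
    have s: "?s \<in> I" using f by (auto simp: I_def)
    have r: "rep ?s \<in> A" "map (rep ?s) [0..<?a] = ?s"
      using s unfolding I_def rep_def by (rule inv_into_into, rule f_inv_into_f)
    have "rep ?s j = f j" if "j < ?a" for j
      using r(2) that by (auto simp: map_eq_conv)
    then have "block_code g (rep ?s) k = block_code g f k" using determined r(1) f by blast
    then have "rep ?s j = f j" if "j \<in> J" for j
      using that unfolding block_code_eq_iff J_def by simp
    then show ?thesis using z(2)[OF s] by simp
  qed
  \<comment> \<open>The last position with a nonzero coefficient is the one that earlier positions
    determine linearly.\<close>
  define n where "n = Max {j \<in> J. z j \<noteq> 0}"
  have "n \<in> {j \<in> J. z j \<noteq> 0}" unfolding n_def using z(1) \<open>finite J\<close> by (intro Max_in) auto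
  then have n: "n \<in> J" "z n \<noteq> 0" by auto
  have above: "z j = 0" if "j \<in> J" "j > n" for j
  proof (rule ccontr)
    assume "z j \<noteq> 0"
    then have "j \<le> n" unfolding n_def using that(1) \<open>finite J\<close> by (intro Max_ge) auto
    then show False using that(2) by simp
  qed
  define c where "c j = (if j \<in> J then - z j / z n else 0)" for j
  have "rat_of_int (f n) = (\<Sum>j<n. c j * rat_of_int (f j))" if f: "f \<in> A" for f
  proof -
    have "0 = (\<Sum>j\<in>J. z j * rat_of_int (f j))" using rel[OF f] by simp
    also have "\<dots> = (\<Sum>j\<in>insert n {j \<in> J. j < n}. z j * rat_of_int (f j))"
      by (rule sum.mono_neutral_right) (use n above \<open>finite J\<close> in \<open>auto, metis linorder_neqE_nat\<close>)
    also have "\<dots> = z n * rat_of_int (f n) + (\<Sum>j\<in>{j \<in> J. j < n}. z j * rat_of_int (f j))"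
      using \<open>finite J\<close> by simp
    finally have "rat_of_int (f n) = - (\<Sum>j\<in>{j \<in> J. j < n}. z j * rat_of_int (f j)) / z n"
      using n(2) by (simp add: field_simps)
    also have "\<dots> = (\<Sum>j\<in>{j \<in> J. j < n}. c j * rat_of_int (f j))"
      by (simp add: c_def sum_divide_distrib sum_negf[symmetric])
    also have "\<dots> = (\<Sum>j<n. c j * rat_of_int (f j))"
      by (rule sum.mono_neutral_left) (auto simp: c_def)
    finally show ?thesis .
  qed
  then show ?thesis using n(1) unfolding J_def by (metis atLeastLessThan_iff)
qed

lemma eventually_bounded_words:
  fixes f :: "nat \<Rightarrow> int"
  assumes "\<forall>\<^sub>\<infinity>n. nat \<bar>f n\<bar> \<le> g n"
  shows "\<forall>\<^sub>\<infinity>k. \<forall>m. map f [0..<m] \<in> bounded_words g k m"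
proof -
  obtain N where N: "\<And>n. n \<ge> N \<Longrightarrow> nat \<bar>f n\<bar> \<le> g n" using assms unfolding MOST_nat_le by blast
  \<comment> \<open>Values below \<open>N\<close> are covered by \<open>k\<close>, all others by the
    sum of \<open>g\<close>.\<close>
  have "map f [0..<m] \<in> bounded_words g k m" if k: "k \<ge> (\<Sum>i<N. nat \<bar>f i\<bar>)" for k m
  proof -
    have "nat \<bar>f j\<bar> \<le> k + (\<Sum>i<m. g i)" if "j < m" for j
    proof (cases "j < N")
      case True
      then have "nat \<bar>f j\<bar> \<le> (\<Sum>i<N. nat \<bar>f i\<bar>)" by (intro member_le_sum) auto
      then show ?thesis using k by simp
    next
      case False
      have "g j \<le> (\<Sum>i<m. g i)" using that by (intro member_le_sum) auto
      then show ?thesis using N[of j] False by simp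
    qed
    then have "\<bar>f j\<bar> \<le> int (k + (\<Sum>i<m. g i))" if "j < m" for j
      using that[THEN \<open>\<And>j. j < m \<Longrightarrow> nat \<bar>f j\<bar> \<le> k + (\<Sum>i<m. g i)\<close>] by linarith
    then show ?thesis unfolding bounded_words_def by (force simp: abs_le_iff)
  qed
  then show ?thesis unfolding MOST_nat_le by blast
qed

lemma bounded_predictable_not_linearly_evading:
  assumes g: "\<And>f. f \<in> F \<Longrightarrow> \<forall>\<^sub>\<infinity>n. nat \<bar>f n\<bar> \<le> g n"
    and "\<not> evading (block_code g ` F)"
  shows "\<not> linearly_evading F"
proof -
  obtain D \<pi> where D: "infinite D" and \<pi>: "\<And>f. f \<in> F \<Longrightarrow> predicts (D, \<pi>) (block_code g f)"
    using assms(2) unfolding evading_def is_predictor_def by auto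
  \<comment> \<open>Every member of \<open>F\<close> lies in \<open>A k\<close> for almost all
    \<open>k \<in> D\<close>, so a relation valid on \<open>A k\<close> predicts it there.\<close>
  define A where "A k = {f. map f [0..<block_start g k] \<in> bounded_words g k (block_start g k) \<and>
    block_code g f k = \<pi> k (vec k (block_code g f))}" for k
  have "\<exists>n c. block_start g k \<le> n \<and> n < block_start g (Suc k) \<and>
      (\<forall>f\<in>A k. rat_of_int (f n) = (\<Sum>j<n. c j * rat_of_int (f j)))" for k
  proof (rule block_linear_relation)
    fix f f' assume f: "f \<in> A k" "f' \<in> A k" and eq: "\<And>j. j < block_start g k \<Longrightarrow> f j = f' j"
    have "block_code g f l = block_code g f' l" if "l < k" for l
    proof -
      have "block_start g (Suc l) \<le> block_start g k"
        using that by (simp only: strict_mono_less_eq[OF strict_mono_block_start] Suc_le_eq)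
      then show ?thesis unfolding block_code_eq_iff using eq by (meson less_le_trans)
    qed
    then have "vec k (block_code g f) = vec k (block_code g f')" by auto
    then show "block_code g f k = block_code g f' k" using f by (simp add: A_def)
  qed (simp add: A_def)
  then obtain n c where n: "\<And>k. block_start g k \<le> n k" "\<And>k. n k < block_start g (Suc k)"
    and c: "\<And>k f. f \<in> A k \<Longrightarrow> rat_of_int (f (n k)) = (\<Sum>j<n k. c k j * rat_of_int (f j))"
    by metis
  have "strict_mono n" unfolding strict_mono_Suc_iff using n by (meson less_le_trans)
  then have inj: "inj n" by (rule strict_mono_imp_inj_on)
  show ?thesis
  \<comment> \<open>The positions \<open>n k\<close> lie in different blocks, so inverting
    \<open>n\<close> recovers the block from the predicted position.\<close>
  proof (rule not_linearly_evadingI[where D = "n ` D" and c = "\<lambda>m. c (inv_into UNIV n m)"])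
    show "infinite (n ` D)" using D inj finite_imageD inj_on_subset by blast
    fix f assume f: "f \<in> F"
    have "\<forall>\<^sub>\<infinity>k. k \<in> D \<longrightarrow> f \<in> A k"
      using MOST_conjI[OF eventually_bounded_words[OF g[OF f]] \<pi>[OF f, unfolded predicts_def prod.case]]
      by (rule MOST_mono) (simp add: A_def)
    then have fin: "finite {k. \<not> (k \<in> D \<longrightarrow> f \<in> A k)}" by (simp only: eventually_cofinite)
    have "{m. \<not> (m \<in> n ` D \<longrightarrow> rat_of_int (f m) = (\<Sum>j<m. c (inv_into UNIV n m) j * rat_of_int (f j)))}
        \<subseteq> n ` {k. \<not> (k \<in> D \<longrightarrow> f \<in> A k)}"
      using c inj by auto
    then show "\<forall>\<^sub>\<infinity>m. m \<in> n ` D \<longrightarrow>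
        rat_of_int (f m) = (\<Sum>j<m. c (inv_into UNIV n m) j * rat_of_int (f j))"
      unfolding eventually_cofinite using fin finite_imageI finite_subset by blast
  qed
qed

section \<open>Comparison of the cardinals\<close>

lemma unbounded_family_UNIV: "unbounded_family UNIV"
  unfolding unbounded_family_def
proof
  fix g :: "nat \<Rightarrow> nat"
  show "\<exists>f\<in>UNIV. \<exists>\<^sub>\<infinity>n. f n > g n" by (intro bexI[of _ "\<lambda>n. Suc (g n)"]) auto
qed

lemma evading_UNIV: "evading (UNIV :: (nat \<Rightarrow> nat) set)"
  unfolding evading_def
proof
  assume "\<exists>P :: nat predictor. is_predictor P \<and> (\<forall>f\<in>UNIV. predicts P f)"
  then obtain D and \<pi> :: "nat \<Rightarrow> nat vec \<Rightarrow> nat"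
    where D: "infinite D" and \<pi>: "\<And>f. predicts (D, \<pi>) f"
    unfolding is_predictor_def by auto
  \<comment> \<open>Diagonalization: each value must refute the guess made from all earlier ones, so
    the recursion carries the list of values so far.\<close>
  define r where "r = rec_nat [] (\<lambda>n l. l @ [Suc (\<pi> n (vec n (\<lambda>i. l ! i)))])"
  have r: "r 0 = []" "\<And>n. r (Suc n) = r n @ [Suc (\<pi> n (vec n (\<lambda>i. r n ! i)))]"
    by (simp_all add: r_def)
  have len: "length (r n) = n" for n by (induction n) (simp_all add: r)
  define f where "f n = r (Suc n) ! n" for n
  have nth: "i < n \<Longrightarrow> r n ! i = f i" for i n
  proof (induction n)
    case (Suc n)
    then show ?case by (cases "i = n") (auto simp: f_def r nth_append len)
  qed simp
  have "f n = Suc (\<pi> n (vec n f))" for n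
  proof -
    have "f n = Suc (\<pi> n (vec n (\<lambda>i. r n ! i)))" unfolding f_def by (simp add: r nth_append len)
    moreover have "vec n (\<lambda>i. r n ! i) = vec n f" using nth by auto
    ultimately show ?thesis by simp
  qed
  then have "f n \<noteq> \<pi> n (vec n f)" for n by (metis n_not_Suc_n)
  then have "\<forall>\<^sub>\<infinity>n. n \<notin> D" using \<pi>[of f] unfolding predicts_def by simp
  then show False using D by (simp add: eventually_cofinite)
qed

lemma bounded_if_card_less:
  fixes A :: "(nat \<Rightarrow> nat) set"
  assumes min: "\<And>B. unbounded_family B \<Longrightarrow> |B0| \<le>o |B|" and A: "|A| <o |B0|"
  shows "\<exists>g. \<forall>f\<in>A. \<forall>\<^sub>\<infinity>n. f n \<le> g n"
proof -
  have "\<not> unbounded_family A" using min A not_ordLess_ordLeq by blast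
  then show ?thesis unfolding unbounded_family_def by (simp add: not_less)
qed

theorem theoremB:
  shows "specker_eda_number =o linear_evasion_number \<and>
         linear_evasion_number =o card_min evasion_number unbounding_number"
proof -
  have se: "specker_eda_number = least_card specker_group"
    unfolding specker_eda_number_def specker_group_def[abs_def] ..
  have b: "unbounding_number = least_card unbounded_family"
    unfolding unbounding_number_def unbounded_family_def[abs_def] ..
  have e: "evasion_number = least_card evading"
    unfolding evasion_number_def evading_def[abs_def] ..
  have el: "linear_evasion_number = least_card linearly_evading"
    unfolding linear_evasion_number_def linearly_evading_def[abs_def] ..
  obtain B where B: "unbounded_family B" "unbounding_number = |B|"
      "\<And>B'. unbounded_family B' \<Longrightarrow> |B| \<le>o |B'|"
    using least_card[of unbounded_family, OF unbounded_family_UNIV] unfolding b by metis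
  obtain E where E: "evading E" "evasion_number = |E|"
      "\<And>E' :: (nat \<Rightarrow> nat) set. evading E' \<Longrightarrow> |E| \<le>o |E'|"
    using least_card[of evading, OF evading_UNIV] unfolding e by metis
  let ?m = "card_min evasion_number unbounding_number"
  have m: "?m \<le>o |E|" "?m \<le>o |B|"
    unfolding card_min_def E(2) B(2)
    using ordLess_imp_ordLeq by auto
  have "\<exists>G. specker_group G \<and> |G| \<le>o ?m"
  proof (cases "|E| <o |B|")
    case True
    then obtain g where "\<And>f. f \<in> E \<Longrightarrow> \<forall>\<^sub>\<infinity>n. f n \<le> g n"
      using bounded_if_card_less[of B E] B(3) by blast
    moreover have "?m = |E|"
      using ordLess_imp_ordLeq[OF True] unfolding card_min_def E(2) B(2) by (simp only: if_True)
    ultimately show ?thesis using bounded_evading_specker_group[OF E(1)] by metis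
  next
    case False
    then have "|B| \<le>o |E|" by simp
    then have "|B| \<le>o ?m"
      unfolding card_min_def E(2) B(2) using ordLeq_refl[OF card_of_Card_order] by auto
    then show ?thesis using unbounded_family_specker_group[OF B(1)] ordLeq_transitive by blast
  qed
  \<comment> \<open>This \<open>G\<close> also shows that the minima defining the Specker-Eda and
    linear evasion numbers are attained.\<close>
  then obtain G where G: "specker_group G" "|G| \<le>o ?m" by blast
  have se_le: "specker_eda_number \<le>o ?m"
    using least_card(2)[of specker_group, OF G(1) G(1)] G(2) ordLeq_transitive unfolding se by blast
  have el_le: "linear_evasion_number \<le>o specker_eda_number"
  proof -
    obtain G' where G': "specker_group G'" "specker_eda_number = |G'|"
      using least_card(1)[of specker_group, OF G(1)] unfolding se by blast
    have "linearly_evading G'" using specker_group_linearly_evading[OF G'(1)] .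
    then show ?thesis unfolding G'(2) el by (rule least_card(2)[rotated]) fact
  qed
  have m_le: "?m \<le>o linear_evasion_number"
  proof -
    obtain L where L: "linearly_evading L" "linear_evasion_number = |L|"
      using least_card(1)[of linearly_evading, OF specker_group_linearly_evading[OF G(1)]]
      unfolding el by blast
    have False if EL: "|L| <o |E|" and BL: "|L| <o |B|"
    proof -
      \<comment> \<open>Boundedness is about natural numbers, so it is applied to absolute values;
        this image and the one under \<open>block_code\<close> are no larger than
        \<open>L\<close>.\<close>
      have "|(\<lambda>f n. nat \<bar>f n\<bar>) ` L| <o |B|" using BL card_of_image ordLeq_ordLess_trans by blast
      then obtain g where g: "\<And>f. f \<in> L \<Longrightarrow> \<forall>\<^sub>\<infinity>n. nat \<bar>f n\<bar> \<le> g n"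
        using bounded_if_card_less[of B "(\<lambda>f n. nat \<bar>f n\<bar>) ` L"] B(3) by auto
      have "|block_code g ` L| <o |E|" using EL card_of_image ordLeq_ordLess_trans by blast
      then have "\<not> evading (block_code g ` L)" using E(3) not_ordLess_ordLeq by blast
      then show False using bounded_predictable_not_linearly_evading[OF g] L(1) by blast
    qed
    then have "|E| \<le>o |L| \<or> |B| \<le>o |L|" by force
    then show ?thesis unfolding L(2) using m ordLeq_transitive by blast
  qed
  show ?thesis
    using se_le el_le m_le ordLeq_transitive[OF se_le m_le] ordLeq_transitive[OF el_le se_le]
    unfolding ordIso_iff_ordLeq by simp
qed

end
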